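(* Let $k$ and $n$ be positive integers. Then the following two numbers are equal: (a) the number of partitions of $n$ with parts not exceeding $k$; (b) the number of $k$-color binary partitions of $n$ in which every part with color $i$ that occurs has multiplicity exactly $i$ (for $1\le i\le k$).
   Context: A $k$-color binary partition of $n$ is a finite multiset of colored parts, each colored part being a power $2^j$ ($j\ge 0$) together with a color $i\in\{1,\dots,k\}$, such that the sum of the parts, counted with multiplicity, is $n$. The order of the parts is irrelevant, and the same power with different colors gives different colored parts. The multiplicity of the colored part $(2^j,i)$ is the number of times it occurs in the multiset. The condition in (b) means that for each pair $(j,i)$ the colored part $(2^j,i)$ occurs either $0$ or exactly $i$ times. *)

theory Defs
  imports Complex_Main "HOL-Library.Multiset"
begin

definition partitions :: "nat \<Rightarrow> nat multiset set" where
  "partitions n = {M. (\<forall>x\<in>#M. 0 < x) \<and> sum_mset M = n}"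

text \<open>A colored part is a pair of its size (the power of two itself, not the exponent)
  and its color.\<close>

definition colored_binary_partitions :: "nat \<Rightarrow> nat \<Rightarrow> (nat \<times> nat) multiset set" where
  "colored_binary_partitions k n =
     {M. (\<forall>(x, i)\<in>#M. (\<exists>j. x = 2 ^ j) \<and> i \<in> {1..k}) \<and> (\<Sum>(x, i)\<in>#M. x) = n}"

end

theory Submission
  imports Defs "HOL-Library.Nat_Bijection"
begin

text \<open>
  A part \<open>i\<close> of multiplicity \<open>m\<close> contributes \<open>m * i\<close> to a partition. Writing
  \<open>m\<close> in binary splits this contribution into the terms \<open>2 ^ j * i\<close>, where \<open>j\<close> runs
  through the positions of the ones of \<open>m\<close>; and such a term can also be read as \<open>i\<close> copies of
  the part \<open>2 ^ j\<close>, coloured \<open>i\<close>. Both kinds of partition therefore record the same data,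
  a finite set of pairs \<open>(j, i)\<close> for which the products \<open>2 ^ j * i\<close> add up to \<open>n\<close>.
  Such a set is turned into a partition by letting each pair stand for \<open>2 ^ j\<close> copies of
  \<open>i\<close>, and into a coloured binary partition by letting it stand for \<open>i\<close> copies of
  \<open>(2 ^ j, i)\<close>. The first map is bijective (lemma \<open>bij_betw_parts_of\<close>) since every
  number is the sum of a unique finite set of powers of two; the second one (lemma
  \<open>bij_betw_colored_parts_of\<close>) since the multiplicity of a coloured part is dictated by its
  colour, so that only the set of occurring parts matters.
\<close>

definition bit_sets :: "nat \<Rightarrow> nat \<Rightarrow> (nat \<times> nat) set set" where
  "bit_sets k n = {E. finite E \<and> snd ` E \<subseteq> {1..k} \<and> (\<Sum>(j, i)\<in>E. 2 ^ j * i) = n}"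

definition parts_of :: "(nat \<times> nat) set \<Rightarrow> nat multiset" where
  "parts_of E = (\<Sum>(j, i)\<in>E. replicate_mset (2 ^ j) i)"

definition colored_parts_of :: "(nat \<times> nat) set \<Rightarrow> (nat \<times> nat) multiset" where
  "colored_parts_of E = (\<Sum>(j, i)\<in>E. replicate_mset i (2 ^ j, i))"

lemma sum_mset_image_parts_of:
  fixes f :: "nat \<Rightarrow> nat"
  assumes "finite E"
  shows "(\<Sum>x\<in>#parts_of E. f x) = (\<Sum>(j, i)\<in>E. 2 ^ j * f i)"
  using assms unfolding parts_of_def by (induction E) (auto simp: case_prod_unfold)

lemma sum_mset_image_colored_parts_of:
  fixes f :: "nat \<times> nat \<Rightarrow> nat"
  assumes "finite E"
  shows "(\<Sum>p\<in>#colored_parts_of E. f p) = (\<Sum>(j, i)\<in>E. i * f (2 ^ j, i))"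
  using assms unfolding colored_parts_of_def by (induction E) (auto simp: case_prod_unfold)

lemma set_mset_parts_of:
  assumes "finite E"
  shows "set_mset (parts_of E) = snd ` E"
  using assms unfolding parts_of_def by (induction E) (auto simp: case_prod_unfold)

text \<open>A pair with second component \<open>0\<close> would leave no trace in the coloured partition.\<close>

lemma set_mset_colored_parts_of:
  assumes "finite E" "0 \<notin> snd ` E"
  shows "set_mset (colored_parts_of E) = (\<lambda>(j, i). (2 ^ j, i)) ` E"
  using assms unfolding colored_parts_of_def
  by (induction E) (auto simp: case_prod_unfold)

text \<open>Binary expansions enter here: \<open>set_encode\<close> is a bijection from the finite sets
  of numbers to the numbers, so the multiplicities determine \<open>E\<close> and may be arbitrary.\<close>

lemma count_parts_of:
  assumes "finite E"
  shows "count (parts_of E) i = set_encode {j. (j, i) \<in> E}"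
proof -
  have "count (parts_of E) i = (\<Sum>p\<in>E. if snd p = i then 2 ^ fst p else 0)"
    using assms unfolding parts_of_def by (induction E) (auto simp: case_prod_unfold)
  also have "\<dots> = (\<Sum>p\<in>{p \<in> E. snd p = i}. 2 ^ fst p)"
    using assms by (simp flip: sum.inter_filter)
  also have "\<dots> = (\<Sum>j\<in>{j. (j, i) \<in> E}. 2 ^ j)"
    by (rule sum.reindex_bij_witness[of _ "\<lambda>j. (j, i)" fst]) auto
  finally show ?thesis by (simp add: set_encode_def)
qed

lemma count_colored_parts_of:
  assumes "finite E"
  shows "count (colored_parts_of E) (2 ^ j, i) = (if (j, i) \<in> E then i else 0)"
  using assms unfolding colored_parts_of_def by (induction E) (auto split: if_splits)

lemma bij_betw_parts_of:
  "bij_betw parts_of (bit_sets k n) {M \<in> partitions n. \<forall>x\<in>#M. x \<le> k}" (is "bij_betw _ _ ?P")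
proof (rule bij_betwI')
  fix E F assume "E \<in> bit_sets k n" "F \<in> bit_sets k n"
  then have fin: "finite E" "finite F" by (auto simp: bit_sets_def)
  have slices: "finite {j. (j, i) \<in> G}" if "finite G" for G :: "(nat \<times> nat) set" and i
    by (rule finite_subset[of _ "fst ` G"]) (use that in \<open>force+\<close>)
  show "parts_of E = parts_of F \<longleftrightarrow> E = F"
  proof
    assume eq: "parts_of E = parts_of F"
    have "{j. (j, i) \<in> E} = {j. (j, i) \<in> F}" for i
      using arg_cong[OF eq, of "\<lambda>M. count M i"] fin slices
      by (simp add: count_parts_of set_encode_eq)
    then show "E = F" by auto
  qed simp
next
  fix E assume "E \<in> bit_sets k n"
  then have E: "finite E" "snd ` E \<subseteq> {1..k}" "(\<Sum>(j, i)\<in>E. 2 ^ j * i) = n"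
    by (auto simp: bit_sets_def)
  then have "sum_mset (parts_of E) = n"
    using sum_mset_image_parts_of[of E "\<lambda>x. x"] by simp
  moreover have "0 < x \<and> x \<le> k" if "x \<in># parts_of E" for x
    using that E set_mset_parts_of[of E] by auto
  ultimately show "parts_of E \<in> ?P" by (simp add: partitions_def)
next
  fix M assume M: "M \<in> ?P"
  define E where "E = {(j, i). j \<in> set_decode (count M i)}"
  \<comment> \<open>\<open>E\<close> is finite because only the parts that occur in \<open>M\<close> have a nonzero digit.\<close>
  have "i \<in># M" if "j \<in> set_decode (count M i)" for j i
    using that by (cases "i \<in># M") (auto simp: not_in_iff)
  then have "E \<subseteq> (\<Union>i\<in>set_mset M. set_decode (count M i) \<times> {i})"
    unfolding E_def by blast
  then have fin: "finite E" by (rule finite_subset) auto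
  have "parts_of E = M"
    by (rule multiset_eqI) (simp add: count_parts_of[OF fin], simp add: E_def)
  moreover from this have "snd ` E \<subseteq> {1..k}"
    unfolding set_mset_parts_of[OF fin, symmetric]
    using M by (auto simp: partitions_def Suc_le_eq)
  ultimately have "E \<in> bit_sets k n"
    using M fin sum_mset_image_parts_of[OF fin, of "\<lambda>x. x"]
    by (simp add: bit_sets_def partitions_def)
  with \<open>parts_of E = M\<close> show "\<exists>E\<in>bit_sets k n. M = parts_of E" by blast
qed

lemma bij_betw_colored_parts_of:
  "bij_betw colored_parts_of (bit_sets k n)
     {M \<in> colored_binary_partitions k n. \<forall>(x, i)\<in>#M. count M (x, i) = i}"
  (is "bij_betw _ _ ?C")
proof (rule bij_betwI')
  fix E F assume "E \<in> bit_sets k n" "F \<in> bit_sets k n"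
  then have EF: "finite E" "finite F" "0 \<notin> snd ` E" "0 \<notin> snd ` F"
    by (auto simp: bit_sets_def)
  have "inj (\<lambda>(j, i). (2 ^ j :: nat, i :: nat))" by (auto simp: inj_def)
  then show "colored_parts_of E = colored_parts_of F \<longleftrightarrow> E = F"
    using set_mset_colored_parts_of[of E] set_mset_colored_parts_of[of F] EF
    by (metis inj_image_eq_iff)
next
  fix E assume "E \<in> bit_sets k n"
  then have E: "finite E" "0 \<notin> snd ` E" "snd ` E \<subseteq> {1..k}" "(\<Sum>(j, i)\<in>E. 2 ^ j * i) = n"
    by (auto simp: bit_sets_def)
  then have "(\<Sum>(x, i)\<in>#colored_parts_of E. x) = n"
    by (simp add: sum_mset_image_colored_parts_of mult.commute)
  then show "colored_parts_of E \<in> ?C"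
    using E by (auto simp: colored_binary_partitions_def set_mset_colored_parts_of
        count_colored_parts_of)
next
  fix M assume M: "M \<in> ?C"
  define E where "E = {(j, i). (2 ^ j, i) \<in># M}"
  have "(\<lambda>(j, i). (2 ^ j, i)) ` E \<subseteq> set_mset M" by (auto simp: E_def)
  moreover have "inj_on (\<lambda>(j, i). (2 ^ j :: nat, i :: nat)) E" by (auto simp: inj_on_def)
  ultimately have fin: "finite E" by (blast intro: inj_on_finite)
  have colors: "snd ` E \<subseteq> {1..k}"
    using M by (auto simp: E_def colored_binary_partitions_def)
  have "colored_parts_of E = M"
  proof (rule multiset_eqI)
    fix p
    show "count (colored_parts_of E) p = count M p"
    proof (cases "\<exists>j i. p = (2 ^ j, i)")
      case True
      then obtain j i where p: "p = (2 ^ j, i)" by blast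
      show ?thesis
        unfolding p count_colored_parts_of[OF fin] using M by (auto simp: E_def not_in_iff)
    next
      case False
      then have "p \<notin># M" using M by (cases p) (auto simp: colored_binary_partitions_def)
      moreover have "p \<notin># colored_parts_of E"
        using False colors by (subst set_mset_colored_parts_of[OF fin]) auto
      ultimately show ?thesis by (simp add: not_in_iff)
    qed
  qed
  moreover from this have "E \<in> bit_sets k n"
    using M fin colors sum_mset_image_colored_parts_of[OF fin, of fst]
    by (simp add: bit_sets_def colored_binary_partitions_def case_prod_unfold mult.commute)
  ultimately show "\<exists>E\<in>bit_sets k n. M = colored_parts_of E" by blast
qed

theorem proposition2p3:
  fixes k n :: nat
  assumes "k \<ge> 1" and "n \<ge> 1"
  shows "card {M \<in> partitions n. \<forall>x\<in>#M. x \<le> k} =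
    card {M \<in> colored_binary_partitions k n. \<forall>(x, i)\<in>#M. count M (x, i) = i}"
  using bij_betw_same_card[OF bij_betw_parts_of, of k n]
    bij_betw_same_card[OF bij_betw_colored_parts_of, of k n]
  by simp

end
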